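(* Let $A$ be an MV-algebra that is generated by one element. If $A$ is semisimple, then $A$ is strongly semisimple.
   Context: An MV-algebra is an algebra $(A,\oplus,\neg,0)$ such that $(A,\oplus,0)$ is a commutative monoid, $\neg\neg a=a$, $a\oplus\neg 0=\neg 0$, and $\neg(\neg a\oplus b)\oplus b=\neg(\neg b\oplus a)\oplus a$ for all $a,b\in A$. Its natural order is given by $a\le b$ iff $\neg a\oplus b=\neg 0$. An ideal of $A$ is a subset containing $0$, closed under $\oplus$, and downward closed for $\le$. An ideal $I$ is proper if $I\neq A$, and maximal if it is maximal among the proper ideals. The quotient $A/I$ is the quotient by the congruence $a\sim b$ iff $\neg(\neg a\oplus b)\oplus\neg(\neg b\oplus a)\in I$. The principal ideal generated by $g\in A$ is $\{a\in A\mid a\le g\oplus\cdots\oplus g \ (k \text{ summands}) \text{ for some } k\ge 0\}$ (the empty sum being $0$). $A$ is semisimple if the intersection of all its maximal ideals is $\{0\}$ (with the empty intersection equal to $A$, so that the trivial one-element algebra counts as semisimple). $A$ is strongly semisimple if for every principal ideal $I$ of $A$ the quotient $A/I$ is semisimple. *)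

theory Defs
  imports "HOL-Analysis.Analysis" "HOL-Algebra.Congruence"
begin

record 'a mv_algebra = "'a partial_object" +
  mv_plus :: "'a \<Rightarrow> 'a \<Rightarrow> 'a" (infixl "\<oplus>\<index>" 65)
  mv_neg  :: "'a \<Rightarrow> 'a" ("\<sim>\<index> _" [81] 80)
  mv_zero :: 'a ("\<zero>\<index>")

locale mv_algebra =
  fixes A (structure)
  assumes zero_closed: "\<zero> \<in> carrier A"
    and plus_closed: "\<lbrakk>a \<in> carrier A; b \<in> carrier A\<rbrakk> \<Longrightarrow> a \<oplus> b \<in> carrier A"
    and neg_closed: "a \<in> carrier A \<Longrightarrow> \<sim> a \<in> carrier A"
    and plus_assoc: "\<lbrakk>a \<in> carrier A; b \<in> carrier A; c \<in> carrier A\<rbrakk>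
      \<Longrightarrow> (a \<oplus> b) \<oplus> c = a \<oplus> (b \<oplus> c)"
    and plus_comm: "\<lbrakk>a \<in> carrier A; b \<in> carrier A\<rbrakk> \<Longrightarrow> a \<oplus> b = b \<oplus> a"
    and plus_zero: "a \<in> carrier A \<Longrightarrow> a \<oplus> \<zero> = a"
    and neg_neg: "a \<in> carrier A \<Longrightarrow> \<sim> (\<sim> a) = a"
    and plus_neg_zero: "a \<in> carrier A \<Longrightarrow> a \<oplus> \<sim> \<zero> = \<sim> \<zero>"
    and lukasiewicz: "\<lbrakk>a \<in> carrier A; b \<in> carrier A\<rbrakk>
      \<Longrightarrow> \<sim> (\<sim> a \<oplus> b) \<oplus> b = \<sim> (\<sim> b \<oplus> a) \<oplus> a"

definition mv_le :: "('a, 'b) mv_algebra_scheme \<Rightarrow> 'a \<Rightarrow> 'a \<Rightarrow> bool" where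
  "mv_le A a b \<longleftrightarrow> \<sim>\<^bsub>A\<^esub> a \<oplus>\<^bsub>A\<^esub> b = \<sim>\<^bsub>A\<^esub> \<zero>\<^bsub>A\<^esub>"

definition mv_ideal :: "('a, 'b) mv_algebra_scheme \<Rightarrow> 'a set \<Rightarrow> bool" where
  "mv_ideal A I \<longleftrightarrow> I \<subseteq> carrier A \<and> \<zero>\<^bsub>A\<^esub> \<in> I \<and> (\<forall>a\<in>I. \<forall>b\<in>I. a \<oplus>\<^bsub>A\<^esub> b \<in> I) \<and>
    (\<forall>b\<in>I. \<forall>a\<in>carrier A. mv_le A a b \<longrightarrow> a \<in> I)"

definition mv_proper_ideal :: "('a, 'b) mv_algebra_scheme \<Rightarrow> 'a set \<Rightarrow> bool" where
  "mv_proper_ideal A I \<longleftrightarrow> mv_ideal A I \<and> I \<noteq> carrier A"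

definition mv_maximal_ideal :: "('a, 'b) mv_algebra_scheme \<Rightarrow> 'a set \<Rightarrow> bool" where
  "mv_maximal_ideal A M \<longleftrightarrow> mv_proper_ideal A M \<and>
    (\<forall>J. mv_proper_ideal A J \<longrightarrow> M \<subseteq> J \<longrightarrow> J = M)"

definition mv_cong :: "('a, 'b) mv_algebra_scheme \<Rightarrow> 'a set \<Rightarrow> ('a \<times> 'a) set" where
  "mv_cong A I = {(a, b). a \<in> carrier A \<and> b \<in> carrier A \<and>
    \<sim>\<^bsub>A\<^esub> (\<sim>\<^bsub>A\<^esub> a \<oplus>\<^bsub>A\<^esub> b) \<oplus>\<^bsub>A\<^esub> \<sim>\<^bsub>A\<^esub> (\<sim>\<^bsub>A\<^esub> b \<oplus>\<^bsub>A\<^esub> a) \<in> I}"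

text \<open>The elements of the quotient are the equivalence classes. The operations take the union of
  the classes of all results obtained from representatives; when the relation is a
  congruence this union is a single class.\<close>

definition mv_quotient :: "('a, 'b) mv_algebra_scheme \<Rightarrow> 'a set \<Rightarrow> 'a set mv_algebra" where
  "mv_quotient A I =
    \<lparr>carrier = carrier A // mv_cong A I,
     mv_plus = (\<lambda>X Y. \<Union>x\<in>X. \<Union>y\<in>Y. mv_cong A I `` {x \<oplus>\<^bsub>A\<^esub> y}),
     mv_neg = (\<lambda>X. \<Union>x\<in>X. mv_cong A I `` {\<sim>\<^bsub>A\<^esub> x}),
     mv_zero = mv_cong A I `` {\<zero>\<^bsub>A\<^esub>}\<rparr>"

primrec mv_multiple :: "('a, 'b) mv_algebra_scheme \<Rightarrow> nat \<Rightarrow> 'a \<Rightarrow> 'a" where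
  "mv_multiple A 0 g = \<zero>\<^bsub>A\<^esub>"
| "mv_multiple A (Suc k) g = mv_multiple A k g \<oplus>\<^bsub>A\<^esub> g"

definition mv_principal_ideal :: "('a, 'b) mv_algebra_scheme \<Rightarrow> 'a \<Rightarrow> 'a set" where
  "mv_principal_ideal A g = {a \<in> carrier A. \<exists>k. mv_le A a (mv_multiple A k g)}"

text \<open>Intersecting with the carrier makes the empty intersection equal to the whole algebra.\<close>

definition mv_semisimple :: "('a, 'b) mv_algebra_scheme \<Rightarrow> bool" where
  "mv_semisimple A \<longleftrightarrow> carrier A \<inter> \<Inter> {M. mv_maximal_ideal A M} = {\<zero>\<^bsub>A\<^esub>}"

definition mv_strongly_semisimple :: "('a, 'b) mv_algebra_scheme \<Rightarrow> bool" where
  "mv_strongly_semisimple A \<longleftrightarrow>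
    (\<forall>g\<in>carrier A. mv_semisimple (mv_quotient A (mv_principal_ideal A g)))"

inductive_set mv_generate :: "('a, 'b) mv_algebra_scheme \<Rightarrow> 'a set \<Rightarrow> 'a set"
  for A (structure) and S where
  zero: "\<zero> \<in> mv_generate A S"
| incl: "a \<in> S \<Longrightarrow> a \<in> mv_generate A S"
| plus: "\<lbrakk>a \<in> mv_generate A S; b \<in> mv_generate A S\<rbrakk> \<Longrightarrow> a \<oplus> b \<in> mv_generate A S"
| neg: "a \<in> mv_generate A S \<Longrightarrow> \<sim> a \<in> mv_generate A S"

end

theory Submission
  imports Defs
begin

text \<open>If \<open>A\<close> is generated by \<open>a\<close>, each \<open>b \<in> A\<close> is given by a continuous, piecewise affine function
  \<open>F\<^sub>b\<close> with \<open>\<phi>(b) = F\<^sub>b(\<phi>(a))\<close> for every homomorphism \<open>\<phi> : A \<rightarrow> [0,1]\<close>, and the points \<open>\<phi>(a)\<close> form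
  a compact set \<open>X\<close>. If \<open>f\<close> lies in all maximal ideals containing \<open>h\<close>, then \<open>F\<^sub>f\<close> vanishes on the
  zeros of \<open>F\<^sub>h\<close> in \<open>X\<close>. On either side of such a zero both functions are affine, so some multiple of
  \<open>F\<^sub>h\<close> dominates \<open>F\<^sub>f\<close> on \<open>X\<close> near that zero; by compactness one multiple works on all of \<open>X\<close>.
  In a semisimple algebra the homomorphisms to \<open>[0,1]\<close> detect the order, because the quotient by a
  maximal ideal is a chain and every nontrivial chain has such a homomorphism; hence \<open>f\<close> lies in the
  ideal generated by \<open>h\<close>.\<close>

section \<open>Arithmetic of MV-algebras\<close>

context mv_algebra
begin

abbreviation one ("\<one>") where "\<one> \<equiv> \<sim> \<zero>"

abbreviation le (infix "\<sqsubseteq>" 50) where "a \<sqsubseteq> b \<equiv> mv_le A a b"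

text \<open>Truncated difference: max 0 (a - b) in the unit interval.\<close>

definition diff (infixl "\<ominus>" 65) where "a \<ominus> b = \<sim> (\<sim> a \<oplus> b)"

text \<open>Lukasiewicz conjunction: max 0 (a + b - 1) in the unit interval, the excess of a + b
  over the unit.\<close>

definition times (infixl "\<odot>" 70) where "a \<odot> b = \<sim> (\<sim> a \<oplus> \<sim> b)"

lemmas closed [simp] = zero_closed plus_closed neg_closed

lemma diff_closed [simp]: "a \<in> carrier A \<Longrightarrow> b \<in> carrier A \<Longrightarrow> a \<ominus> b \<in> carrier A"
  by (simp add: diff_def)

lemma times_closed [simp]: "a \<in> carrier A \<Longrightarrow> b \<in> carrier A \<Longrightarrow> a \<odot> b \<in> carrier A"
  by (simp add: times_def)

lemma multiple_closed [simp]: "a \<in> carrier A \<Longrightarrow> mv_multiple A n a \<in> carrier A"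
  by (induction n) auto

lemma plus_left_comm:
  "a \<in> carrier A \<Longrightarrow> b \<in> carrier A \<Longrightarrow> c \<in> carrier A \<Longrightarrow> a \<oplus> (b \<oplus> c) = b \<oplus> (a \<oplus> c)"
  by (metis plus_assoc plus_comm)

lemmas plus_ac = plus_assoc plus_comm plus_left_comm

lemma zero_plus [simp]: "a \<in> carrier A \<Longrightarrow> \<zero> \<oplus> a = a"
  using plus_comm plus_zero by simp

lemmas basic_simps [simp] = plus_zero neg_neg plus_neg_zero

lemma one_plus [simp]: "a \<in> carrier A \<Longrightarrow> \<one> \<oplus> a = \<one>"
  by (metis neg_closed plus_comm plus_neg_zero zero_closed)

lemma neg_plus_self [simp]: "a \<in> carrier A \<Longrightarrow> \<sim> a \<oplus> a = \<one>"
  \<comment> \<open>With \<open>\<one>\<close> for b the left side of the axiom collapses to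
    \<open>\<one>\<close> and the right side to \<open>\<sim> a \<oplus> a\<close>.\<close>
  using lukasiewicz[of a "\<one>"] by simp

lemma self_plus_neg [simp]: "a \<in> carrier A \<Longrightarrow> a \<oplus> \<sim> a = \<one>"
  by (metis neg_closed neg_plus_self plus_comm)

lemma diff_self [simp]: "a \<in> carrier A \<Longrightarrow> a \<ominus> a = \<zero>"
  by (simp add: diff_def)

lemma diff_zero [simp]: "a \<in> carrier A \<Longrightarrow> a \<ominus> \<zero> = a"
  by (simp add: diff_def)

lemma zero_diff [simp]: "a \<in> carrier A \<Longrightarrow> \<zero> \<ominus> a = \<zero>"
  by (simp add: diff_def)

lemma le_iff_diff: "a \<in> carrier A \<Longrightarrow> b \<in> carrier A \<Longrightarrow> a \<sqsubseteq> b \<longleftrightarrow> a \<ominus> b = \<zero>"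
  by (metis closed(1,2,3) diff_def mv_le_def neg_neg)

text \<open>Residuation: subtracting b is left adjoint to adding b, so estimates on differences
  reduce to estimates on sums.\<close>

lemma diff_le_iff:
  "a \<in> carrier A \<Longrightarrow> b \<in> carrier A \<Longrightarrow> c \<in> carrier A \<Longrightarrow> a \<ominus> b \<sqsubseteq> c \<longleftrightarrow> a \<sqsubseteq> b \<oplus> c"
  by (simp add: mv_le_def diff_def plus_assoc)

lemma le_refl [simp]: "a \<in> carrier A \<Longrightarrow> a \<sqsubseteq> a"
  by (simp add: mv_le_def)

lemma zero_le [simp]: "a \<in> carrier A \<Longrightarrow> \<zero> \<sqsubseteq> a"
  by (simp add: mv_le_def)

lemma le_one [simp]: "a \<in> carrier A \<Longrightarrow> a \<sqsubseteq> \<one>"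
  by (simp add: mv_le_def)

text \<open>Both sides are the join of a and b; this is the Lukasiewicz axiom in terms of
  differences.\<close>

lemma plus_diff_commute: "a \<in> carrier A \<Longrightarrow> b \<in> carrier A \<Longrightarrow> b \<oplus> (a \<ominus> b) = a \<oplus> (b \<ominus> a)"
  using lukasiewicz[of a b] by (simp add: diff_def plus_comm)

lemma le_plus_diff: "a \<in> carrier A \<Longrightarrow> b \<in> carrier A \<Longrightarrow> a \<sqsubseteq> b \<Longrightarrow> a \<oplus> (b \<ominus> a) = b"
  using plus_diff_commute[of a b] by (simp add: le_iff_diff)

lemma le_antisym: "a \<in> carrier A \<Longrightarrow> b \<in> carrier A \<Longrightarrow> a \<sqsubseteq> b \<Longrightarrow> b \<sqsubseteq> a \<Longrightarrow> a = b"
  by (metis le_iff_diff le_plus_diff plus_zero)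

lemma le_plus [simp]: "a \<in> carrier A \<Longrightarrow> b \<in> carrier A \<Longrightarrow> a \<sqsubseteq> a \<oplus> b"
  by (simp add: mv_le_def flip: plus_assoc)

lemma le_plus' [simp]: "a \<in> carrier A \<Longrightarrow> b \<in> carrier A \<Longrightarrow> a \<sqsubseteq> b \<oplus> a"
  using le_plus plus_comm by simp

lemma le_trans:
  assumes "a \<in> carrier A" "b \<in> carrier A" "c \<in> carrier A" "a \<sqsubseteq> b" "b \<sqsubseteq> c"
  shows "a \<sqsubseteq> c"
proof -
  have "c = a \<oplus> ((b \<ominus> a) \<oplus> (c \<ominus> b))"
    using assms le_plus_diff[of a b] le_plus_diff[of b c] by (simp flip: plus_assoc)
  then show ?thesis
    using assms le_plus[of a "(b \<ominus> a) \<oplus> (c \<ominus> b)"] by simp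
qed

lemma plus_mono_left:
  assumes "a \<in> carrier A" "b \<in> carrier A" "c \<in> carrier A" "a \<sqsubseteq> b"
  shows "a \<oplus> c \<sqsubseteq> b \<oplus> c"
proof -
  have "b \<oplus> c = (a \<oplus> c) \<oplus> (b \<ominus> a)"
    using assms le_plus_diff[of a b] by (metis diff_closed plus_assoc plus_comm)
  then show ?thesis
    using assms by simp
qed

lemma plus_mono:
  assumes "a \<in> carrier A" "b \<in> carrier A" "c \<in> carrier A" "d \<in> carrier A" "a \<sqsubseteq> b" "c \<sqsubseteq> d"
  shows "a \<oplus> c \<sqsubseteq> b \<oplus> d"
  by (metis assms le_trans plus_closed plus_comm plus_mono_left)

lemma neg_le_iff [simp]: "a \<in> carrier A \<Longrightarrow> b \<in> carrier A \<Longrightarrow> \<sim> a \<sqsubseteq> \<sim> b \<longleftrightarrow> b \<sqsubseteq> a"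
  by (simp add: mv_le_def plus_comm)

lemma le_plus_diff_self: "a \<in> carrier A \<Longrightarrow> b \<in> carrier A \<Longrightarrow> a \<sqsubseteq> b \<oplus> (a \<ominus> b)"
  using diff_le_iff[of a b "a \<ominus> b"] by simp

lemma diff_le: "a \<in> carrier A \<Longrightarrow> b \<in> carrier A \<Longrightarrow> a \<ominus> b \<sqsubseteq> a"
  by (simp add: diff_le_iff)

lemma diff_triangle:
  assumes "a \<in> carrier A" "b \<in> carrier A" "c \<in> carrier A"
  shows "a \<ominus> c \<sqsubseteq> (a \<ominus> b) \<oplus> (b \<ominus> c)"
proof -
  have "b \<oplus> (a \<ominus> b) \<sqsubseteq> c \<oplus> (b \<ominus> c) \<oplus> (a \<ominus> b)"
    using assms by (intro plus_mono_left le_plus_diff_self) auto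
  then have "a \<sqsubseteq> c \<oplus> (b \<ominus> c) \<oplus> (a \<ominus> b)"
    using assms le_plus_diff_self[of a b] by (auto intro: le_trans[of a "b \<oplus> (a \<ominus> b)"])
  then show ?thesis
    using assms by (simp add: diff_le_iff plus_ac)
qed

lemma diff_plus_plus_le:
  assumes "a \<in> carrier A" "b \<in> carrier A" "c \<in> carrier A" "d \<in> carrier A"
  shows "(a \<oplus> b) \<ominus> (c \<oplus> d) \<sqsubseteq> (a \<ominus> c) \<oplus> (b \<ominus> d)"
proof -
  have "a \<oplus> b \<sqsubseteq> (c \<oplus> (a \<ominus> c)) \<oplus> (d \<oplus> (b \<ominus> d))"
    using assms by (intro plus_mono le_plus_diff_self) auto
  then show ?thesis
    using assms by (simp add: diff_le_iff plus_ac)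
qed

lemma neg_diff_neg: "a \<in> carrier A \<Longrightarrow> b \<in> carrier A \<Longrightarrow> \<sim> a \<ominus> \<sim> b = b \<ominus> a"
  by (simp add: diff_def plus_comm)

lemma diff_plus: "a \<in> carrier A \<Longrightarrow> b \<in> carrier A \<Longrightarrow> c \<in> carrier A \<Longrightarrow> a \<ominus> (b \<oplus> c) = a \<ominus> b \<ominus> c"
  by (simp add: diff_def plus_assoc)

text \<open>The hypothesis says that the sum of a and b is not truncated, so a can be cancelled. In
  the axiom at \<open>\<sim> b\<close> and a it reduces one side to \<open>\<sim> b\<close>.\<close>

lemma plus_diff_cancel:
  assumes "a \<in> carrier A" "b \<in> carrier A" "b \<sqsubseteq> \<sim> a"
  shows "(a \<oplus> b) \<ominus> a = b"
proof -
  have "\<sim> (a \<oplus> b) \<oplus> a = \<sim> b"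
    using lukasiewicz[of "\<sim> b" a] assms by (simp add: plus_comm mv_le_def)
  then show ?thesis
    using assms by (simp add: diff_def)
qed

section \<open>Meets and disjointness\<close>

lemma le_diff_diff:
  assumes "a \<in> carrier A" "b \<in> carrier A" "c \<in> carrier A" "c \<sqsubseteq> a" "c \<sqsubseteq> b"
  shows "c \<sqsubseteq> a \<ominus> (a \<ominus> b)"
proof -
  \<comment> \<open>Negation turns \<open>a \<ominus> (a \<ominus> b)\<close> into the join of
    \<open>\<sim> a\<close> and \<open>\<sim> b\<close>, which is bounded here by
    \<open>\<sim> c\<close>.\<close>
  have "\<sim> a \<oplus> (\<sim> b \<ominus> \<sim> a) \<sqsubseteq> \<sim> a \<oplus> (\<sim> c \<ominus> \<sim> a)"
    using assms by (intro plus_mono; simp add: diff_le_iff le_plus_diff)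
  also have "\<sim> a \<oplus> (\<sim> c \<ominus> \<sim> a) = \<sim> c"
    using assms by (simp add: le_plus_diff)
  finally show ?thesis
    using assms by (simp add: neg_diff_neg) (metis assms(1-3) diff_closed diff_def neg_closed neg_le_iff neg_neg plus_closed)
qed

lemma diff_diff_le:
  assumes "a \<in> carrier A" "b \<in> carrier A"
  shows "a \<ominus> (a \<ominus> b) \<sqsubseteq> b"
  using assms by (metis diff_closed diff_le_iff le_plus_diff_self plus_comm)

lemma diff_diff_diff:
  assumes "a \<in> carrier A" "b \<in> carrier A"
  shows "a \<ominus> (a \<ominus> (a \<ominus> b)) = a \<ominus> b"
  using assms by (intro le_antisym diff_diff_le le_diff_diff diff_le) auto

lemma diff_diff_commute:
  assumes "a \<in> carrier A" "b \<in> carrier A"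
  shows "a \<ominus> (a \<ominus> b) = b \<ominus> (b \<ominus> a)"
  using assms by (intro le_antisym le_diff_diff diff_diff_le diff_le) auto

text \<open>With c the meet of a and b, the two differences are \<open>a \<ominus> c\<close> and
  \<open>b \<ominus> c\<close>. A common lower bound w can be added to c without leaving the lower
  bounds of a and b, so \<open>c \<oplus> w = c\<close>, and cancelling c leaves w = 0.\<close>

lemma diff_disjoint:
  assumes "a \<in> carrier A" "b \<in> carrier A" "w \<in> carrier A" "w \<sqsubseteq> a \<ominus> b" "w \<sqsubseteq> b \<ominus> a"
  shows "w = \<zero>"
proof -
  define c where "c = a \<ominus> (a \<ominus> b)"
  have c: "c \<in> carrier A" "c \<sqsubseteq> a" "c \<sqsubseteq> b"
    using assms by (auto simp: c_def diff_le diff_diff_le)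
  have wa: "w \<sqsubseteq> a \<ominus> c"
    using assms by (simp add: c_def diff_diff_diff)
  have wb: "w \<sqsubseteq> b \<ominus> c"
    using assms by (simp add: c_def diff_diff_diff diff_diff_commute[of a b])
  have "c \<oplus> w \<sqsubseteq> c \<oplus> (a \<ominus> c)" "c \<oplus> w \<sqsubseteq> c \<oplus> (b \<ominus> c)"
    using assms c wa wb by (auto intro!: plus_mono)
  then have "c \<oplus> w \<sqsubseteq> a" "c \<oplus> w \<sqsubseteq> b"
    using assms c by (auto simp: le_plus_diff)
  then have "c \<oplus> w \<sqsubseteq> c"
    using assms c unfolding c_def by (intro le_diff_diff) auto
  then have eq: "c \<oplus> w = c"
    using assms c by (intro le_antisym) auto
  have "a \<ominus> c \<sqsubseteq> \<sim> c"
    using assms c by (simp add: diff_le_iff)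
  then have "w \<sqsubseteq> \<sim> c"
    using assms c wa by (meson diff_closed le_trans neg_closed)
  then have "(c \<oplus> w) \<ominus> c = w"
    using assms c by (intro plus_diff_cancel) auto
  then show ?thesis
    using eq c by simp
qed

lemma disjoint_multiple:
  assumes "u \<in> carrier A" "v \<in> carrier A" "\<And>w. w \<in> carrier A \<Longrightarrow> w \<sqsubseteq> u \<Longrightarrow> w \<sqsubseteq> v \<Longrightarrow> w = \<zero>"
    and "w \<in> carrier A" "w \<sqsubseteq> u" "w \<sqsubseteq> mv_multiple A n v"
  shows "w = \<zero>"
  using assms(6)
proof (induction n)
  case 0
  then show ?case
    using assms(4) by (intro le_antisym) auto
next
  case (Suc n)
  let ?w = "w \<ominus> mv_multiple A n v"
  have "?w \<sqsubseteq> v"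
    using Suc.prems assms by (simp add: diff_le_iff)
  moreover have "?w \<sqsubseteq> u"
    using assms by (meson diff_closed diff_le le_trans multiple_closed)
  ultimately have "?w = \<zero>"
    using assms by simp
  then have "w \<sqsubseteq> mv_multiple A n v"
    using assms(2,4) by (simp add: le_iff_diff)
  then show ?case
    by (rule Suc.IH)
qed

lemma multiple_add:
  "a \<in> carrier A \<Longrightarrow> mv_multiple A (m + n) a = mv_multiple A m a \<oplus> mv_multiple A n a"
  by (induction n) (auto simp: plus_assoc)

section \<open>The Lukasiewicz product and its interplay with the sum\<close>

lemma times_comm: "a \<in> carrier A \<Longrightarrow> b \<in> carrier A \<Longrightarrow> a \<odot> b = b \<odot> a"
  by (simp add: times_def plus_comm)

lemma times_assoc:
  "a \<in> carrier A \<Longrightarrow> b \<in> carrier A \<Longrightarrow> c \<in> carrier A \<Longrightarrow> a \<odot> b \<odot> c = a \<odot> (b \<odot> c)"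
  by (simp add: times_def plus_assoc)

text \<open>Needed for associativity of addition with carry when neither x + y nor y + z exceeds the
  unit. Since \<open>\<sim> x\<close> splits as y plus \<open>\<sim> (x \<oplus> y)\<close>,
  cancelling y reduces both sides to \<open>z \<ominus> \<sim> (x \<oplus> y)\<close>.\<close>

lemma plus_times_disjoint:
  assumes "x \<in> carrier A" "y \<in> carrier A" "z \<in> carrier A" "y \<sqsubseteq> \<sim> x" "z \<sqsubseteq> \<sim> y"
  shows "(x \<oplus> y) \<odot> z = x \<odot> (y \<oplus> z)"
proof -
  let ?w = "\<sim> (x \<oplus> y)"
  have "y \<oplus> ?w = \<sim> x"
    using le_plus_diff[of y "\<sim> x"] assms by (simp add: diff_def)
  then have "x \<odot> (y \<oplus> z) = (y \<oplus> z) \<ominus> (y \<oplus> ?w)"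
    using assms by (simp add: times_def diff_def plus_comm)
  also have "\<dots> = (y \<oplus> z) \<ominus> y \<ominus> ?w"
    using assms by (simp add: diff_plus)
  also have "\<dots> = z \<ominus> ?w"
    using assms by (simp add: plus_diff_cancel)
  also have "\<dots> = (x \<oplus> y) \<odot> z"
    using assms by (simp add: times_def diff_def plus_comm)
  finally show ?thesis ..
qed

text \<open>The dual case, in which both sums reach the unit; it follows from the previous lemma for
  the negated elements.\<close>

lemma times_plus_exhaustive:
  assumes "x \<in> carrier A" "y \<in> carrier A" "z \<in> carrier A" "x \<oplus> y = \<one>" "y \<oplus> z = \<one>"
  shows "x \<odot> y \<oplus> z = x \<oplus> y \<odot> z"
proof -
  have "(\<sim> x \<oplus> \<sim> y) \<odot> \<sim> z = \<sim> x \<odot> (\<sim> y \<oplus> \<sim> z)"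
    using assms by (intro plus_times_disjoint) (auto simp: mv_le_def plus_comm)
  then have "\<sim> ((\<sim> x \<oplus> \<sim> y) \<odot> \<sim> z) = \<sim> (\<sim> x \<odot> (\<sim> y \<oplus> \<sim> z))"
    by simp
  then show ?thesis
    using assms by (simp add: times_def)
qed


subsection \<open>Ideals and quotients\<close>

lemma ideal_downD: "mv_ideal A I \<Longrightarrow> b \<in> I \<Longrightarrow> a \<in> carrier A \<Longrightarrow> a \<sqsubseteq> b \<Longrightarrow> a \<in> I"
  by (auto simp: mv_ideal_def)

lemma ideal_carrierD: "mv_ideal A I \<Longrightarrow> a \<in> I \<Longrightarrow> a \<in> carrier A"
  by (auto simp: mv_ideal_def)

lemma ideal_plus_iff:
  assumes "mv_ideal A I" "a \<in> carrier A" "b \<in> carrier A"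
  shows "a \<oplus> b \<in> I \<longleftrightarrow> a \<in> I \<and> b \<in> I"
proof
  assume "a \<oplus> b \<in> I"
  then show "a \<in> I \<and> b \<in> I"
    using assms by (auto intro: ideal_downD)
qed (use assms in \<open>auto simp: mv_ideal_def\<close>)

lemma ideal_multiple: "mv_ideal A I \<Longrightarrow> a \<in> I \<Longrightarrow> mv_multiple A n a \<in> I"
  by (induction n) (auto simp: mv_ideal_def)

lemma mv_cong_iff:
  assumes "mv_ideal A I"
  shows "(a, b) \<in> mv_cong A I \<longleftrightarrow>
    a \<in> carrier A \<and> b \<in> carrier A \<and> a \<ominus> b \<in> I \<and> b \<ominus> a \<in> I"
  using ideal_plus_iff[OF assms] by (auto simp: mv_cong_def diff_def)

lemma equiv_mv_cong:
  assumes "mv_ideal A I"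
  shows "equiv (carrier A) (mv_cong A I)"
proof (rule equivI)
  show "refl_on (carrier A) (mv_cong A I)"
    using assms by (auto simp: refl_on_def mv_cong_iff mv_ideal_def)
  show "sym (mv_cong A I)"
    using assms by (auto simp: sym_def mv_cong_iff)
  have "a \<ominus> c \<in> I"
    if "a \<in> carrier A" "b \<in> carrier A" "c \<in> carrier A" "a \<ominus> b \<in> I" "b \<ominus> c \<in> I" for a b c
    using that assms
    by (intro ideal_downD[OF assms _ _ diff_triangle[of a b c]]) (auto simp: ideal_plus_iff)
  then show "trans (mv_cong A I)"
    unfolding trans_def mv_cong_iff[OF assms] by blast
qed (auto simp: mv_cong_def)

lemma plus_congruent:
  assumes "mv_ideal A I" "(a, c) \<in> mv_cong A I" "(b, d) \<in> mv_cong A I"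
  shows "(a \<oplus> b, c \<oplus> d) \<in> mv_cong A I"
proof -
  have "(a \<oplus> b) \<ominus> (c \<oplus> d) \<in> I"
    if "a \<in> carrier A" "b \<in> carrier A" "c \<in> carrier A" "d \<in> carrier A" "a \<ominus> c \<in> I" "b \<ominus> d \<in> I"
    for a b c d
    using that assms(1)
    by (intro ideal_downD[OF assms(1) _ _ diff_plus_plus_le]) (auto simp: ideal_plus_iff)
  then show ?thesis
    using assms by (simp add: mv_cong_iff)
qed

lemma neg_congruent:
  assumes "mv_ideal A I" "(a, b) \<in> mv_cong A I"
  shows "(\<sim> a, \<sim> b) \<in> mv_cong A I"
  using assms by (simp add: mv_cong_iff neg_diff_neg)

lemma quotient_plus:
  assumes "mv_ideal A I" "a \<in> carrier A" "b \<in> carrier A"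
  shows "mv_plus (mv_quotient A I) (mv_cong A I `` {a}) (mv_cong A I `` {b}) = mv_cong A I `` {a \<oplus> b}"
proof -
  note e = equiv_mv_cong[OF assms(1)]
  have "(\<lambda>x y. mv_cong A I `` {x \<oplus> y}) respects2 mv_cong A I"
    by (intro congruent2I' equiv_class_eq[OF e] plus_congruent assms(1))
  then show ?thesis
    using UN_equiv_class2[OF e e _ assms(2,3)] by (simp add: mv_quotient_def)
qed

lemma quotient_neg:
  assumes "mv_ideal A I" "a \<in> carrier A"
  shows "mv_neg (mv_quotient A I) (mv_cong A I `` {a}) = mv_cong A I `` {\<sim> a}"
proof -
  note e = equiv_mv_cong[OF assms(1)]
  have "(\<lambda>x. mv_cong A I `` {\<sim> x}) respects mv_cong A I"
    by (intro congruentI equiv_class_eq[OF e] neg_congruent assms(1))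
  then show ?thesis
    using UN_equiv_class[OF e _ assms(2)] by (simp add: mv_quotient_def)
qed

lemma carrier_quotient: "carrier (mv_quotient A I) = (\<lambda>a. mv_cong A I `` {a}) ` carrier A"
  by (auto simp: mv_quotient_def quotient_def)

lemma zero_quotient: "mv_zero (mv_quotient A I) = mv_cong A I `` {\<zero>}"
  by (simp add: mv_quotient_def)

lemma mv_algebra_quotient:
  assumes "mv_ideal A I"
  shows "mv_algebra (mv_quotient A I)"
  by unfold_locales
    (auto simp: carrier_quotient zero_quotient quotient_plus quotient_neg assms plus_assoc
      lukasiewicz, simp_all add: plus_comm)

lemma quotient_class_eq_iff:
  assumes "mv_ideal A I" "a \<in> carrier A" "b \<in> carrier A"
  shows "mv_cong A I `` {a} = mv_cong A I `` {b} \<longleftrightarrow> a \<ominus> b \<in> I \<and> b \<ominus> a \<in> I"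
  using eq_equiv_class_iff[OF equiv_mv_cong[OF assms(1)] assms(2,3)] assms by (simp add: mv_cong_iff)

lemma quotient_class_zero_iff:
  assumes "mv_ideal A I" "a \<in> carrier A"
  shows "mv_cong A I `` {a} = mv_cong A I `` {\<zero>} \<longleftrightarrow> a \<in> I"
  using quotient_class_eq_iff[OF assms zero_closed] assms by (auto simp: mv_ideal_def)

lemma quotient_le_iff:
  assumes "mv_ideal A I" "a \<in> carrier A" "b \<in> carrier A"
  shows "mv_le (mv_quotient A I) (mv_cong A I `` {a}) (mv_cong A I `` {b}) \<longleftrightarrow> a \<ominus> b \<in> I"
proof -
  interpret Q: mv_algebra "mv_quotient A I"
    using assms(1) by (rule mv_algebra_quotient)
  show ?thesis
    using assms quotient_class_zero_iff[of I "a \<ominus> b"]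
    by (simp add: Q.le_iff_diff carrier_quotient Q.diff_def quotient_neg quotient_plus zero_quotient
        diff_def)
qed

lemma ideal_principal:
  assumes "g \<in> carrier A"
  shows "mv_ideal A (mv_principal_ideal A g)"
proof -
  have "a \<oplus> b \<sqsubseteq> mv_multiple A (m + n) g"
    if "a \<in> carrier A" "b \<in> carrier A" "a \<sqsubseteq> mv_multiple A m g" "b \<sqsubseteq> mv_multiple A n g" for a b m n
    using that assms by (simp add: multiple_add plus_mono)
  moreover have "\<zero> \<sqsubseteq> mv_multiple A 0 g"
    by simp
  ultimately show ?thesis
    using assms unfolding mv_ideal_def mv_principal_ideal_def
    by (force intro: le_trans[OF _ _ multiple_closed])
qed

section \<open>Maximal ideals\<close>

lemma ideal_extend:
  assumes "mv_ideal A M" "u \<in> carrier A"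
  defines "J \<equiv> {x \<in> carrier A. \<exists>m\<in>M. \<exists>n. x \<sqsubseteq> m \<oplus> mv_multiple A n u}"
  shows "mv_ideal A J" "M \<subseteq> J" "u \<in> J"
proof -
  have sub: "M \<subseteq> carrier A"
    using assms by (auto simp: mv_ideal_def)
  have zero: "\<zero> \<in> M"
    using assms by (auto simp: mv_ideal_def)
  show MJ: "M \<subseteq> J"
  proof
    fix x assume "x \<in> M"
    then show "x \<in> J"
      using sub by (auto simp: J_def intro!: bexI[of _ x] exI[of _ 0])
  qed
  show "u \<in> J"
    using assms(2) zero by (auto simp: J_def intro!: bexI[of _ \<zero>] exI[of _ 1])
  have "x \<oplus> y \<in> J" if "x \<in> J" "y \<in> J" for x y
  proof -
    obtain m n m' n' where xy: "x \<in> carrier A" "y \<in> carrier A" "m \<in> M" "m' \<in> M"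
      "x \<sqsubseteq> m \<oplus> mv_multiple A n u" "y \<sqsubseteq> m' \<oplus> mv_multiple A n' u"
      using \<open>x \<in> J\<close> \<open>y \<in> J\<close> by (auto simp: J_def)
    then have m: "m \<in> carrier A" "m' \<in> carrier A"
      using sub by auto
    have "x \<oplus> y \<sqsubseteq> (m \<oplus> mv_multiple A n u) \<oplus> (m' \<oplus> mv_multiple A n' u)"
      using xy m assms(2) by (intro plus_mono) auto
    also have "\<dots> = (m \<oplus> m') \<oplus> mv_multiple A (n + n') u"
      using m assms(2) by (simp add: multiple_add plus_ac)
    finally show ?thesis
      using xy assms(1) ideal_plus_iff[OF assms(1) m] by (auto simp: J_def)
  qed
  moreover have "x \<in> J" if xy: "x \<in> carrier A" "y \<in> J" "x \<sqsubseteq> y" for x y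
  proof -
    obtain m n where "y \<in> carrier A" "m \<in> M" "y \<sqsubseteq> m \<oplus> mv_multiple A n u"
      using \<open>y \<in> J\<close> by (auto simp: J_def)
    moreover from this have "x \<sqsubseteq> m \<oplus> mv_multiple A n u"
      using xy assms(2) sub by (intro le_trans[OF _ _ _ \<open>x \<sqsubseteq> y\<close>]) auto
    ultimately show ?thesis
      using xy(1) by (auto simp: J_def)
  qed
  ultimately show "mv_ideal A J"
    using MJ zero by (auto simp: mv_ideal_def J_def)
qed

lemma maximal_idealD:
  assumes "mv_maximal_ideal A M"
  shows "mv_ideal A M" "\<one> \<notin> M"
proof -
  show M: "mv_ideal A M"
    using assms by (simp add: mv_maximal_ideal_def mv_proper_ideal_def)
  show "\<one> \<notin> M"
  proof
    assume "\<one> \<in> M"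
    then have "a \<in> M" if "a \<in> carrier A" for a
      using ideal_downD[OF M _ that le_one] that by simp
    then have "M = carrier A"
      using M by (auto simp: mv_ideal_def)
    then show False
      using assms by (simp add: mv_maximal_ideal_def mv_proper_ideal_def)
  qed
qed

text \<open>By maximality the ideal generated by M and u is the whole algebra, so it contains
  \<open>\<one>\<close>.\<close>

lemma maximal_ideal_escape:
  assumes "mv_maximal_ideal A M" "u \<in> carrier A" "u \<notin> M"
  obtains m n where "m \<in> M" "m \<oplus> mv_multiple A n u = \<one>"
proof -
  note M = maximal_idealD[OF assms(1)]
  define J where "J = {x \<in> carrier A. \<exists>m\<in>M. \<exists>n. x \<sqsubseteq> m \<oplus> mv_multiple A n u}"
  have "mv_ideal A J" "M \<subseteq> J" "u \<in> J"
    unfolding J_def using ideal_extend[OF M(1) assms(2)] by auto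
  then have "J = carrier A"
    using assms by (auto simp: mv_maximal_ideal_def mv_proper_ideal_def)
  then have "\<one> \<in> J"
    by simp
  then obtain m n where mn: "m \<in> M" "\<one> \<sqsubseteq> m \<oplus> mv_multiple A n u"
    by (auto simp: J_def)
  moreover have "m \<in> carrier A"
    using mn M ideal_carrierD by auto
  ultimately have "m \<oplus> mv_multiple A n u = \<one>"
    using assms(2) by (intro le_antisym) auto
  then show ?thesis
    using that mn by blast
qed

text \<open>This makes the quotient by M a chain. If both differences escaped M, some
  \<open>\<sim> (m \<oplus> m')\<close> with m and m' in M would lie below a multiple of each.
  Multiples of disjoint elements are disjoint, so \<open>m \<oplus> m'\<close> would be
  \<open>\<one>\<close>, which is not in M.\<close>

lemma maximal_ideal_total:
  assumes M: "mv_maximal_ideal A M" and ab: "a \<in> carrier A" "b \<in> carrier A"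
  shows "a \<ominus> b \<in> M \<or> b \<ominus> a \<in> M"
proof (rule ccontr)
  let ?u = "a \<ominus> b" and ?v = "b \<ominus> a"
  assume "\<not> ?thesis"
  then obtain m n m' n' where
    m: "m \<in> M" "m \<oplus> mv_multiple A n ?u = \<one>" "m' \<in> M" "m' \<oplus> mv_multiple A n' ?v = \<one>"
    using ab by (metis diff_closed maximal_ideal_escape[OF M])
  note I = maximal_idealD[OF M]
  have mc: "m \<in> carrier A" "m' \<in> carrier A"
    using m I ideal_carrierD by auto
  let ?w = "\<sim> (m \<oplus> m')"
  have le_neg: "\<sim> x \<sqsubseteq> y" if "x \<in> carrier A" "y \<in> carrier A" "x \<oplus> y = \<one>" for x y
    using that by (simp add: mv_le_def)
  have "m \<oplus> m' \<oplus> mv_multiple A n ?u = m' \<oplus> (m \<oplus> mv_multiple A n ?u)"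
    using mc ab by (simp add: plus_ac)
  then have wu: "?w \<sqsubseteq> mv_multiple A n ?u"
    using m mc ab by (intro le_neg) auto
  have "m \<oplus> m' \<oplus> mv_multiple A n' ?v = m \<oplus> (m' \<oplus> mv_multiple A n' ?v)"
    using mc ab by (simp add: plus_ac)
  then have wv: "?w \<sqsubseteq> mv_multiple A n' ?v"
    using m mc ab by (intro le_neg) auto
  have disj: "w = \<zero>" if "w \<in> carrier A" "w \<sqsubseteq> ?v" "w \<sqsubseteq> mv_multiple A n ?u" for w
    using disjoint_multiple[of ?v ?u w n] that ab by (auto intro: diff_disjoint)
  have "?w = \<zero>"
    using disjoint_multiple[of "mv_multiple A n ?u" ?v ?w n'] wu wv mc ab
    by (auto intro: disj)
  then have "m \<oplus> m' = \<one>"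
    using mc by (metis neg_neg plus_closed)
  moreover have "m \<oplus> m' \<in> M"
    using I m by (auto simp: mv_ideal_def)
  ultimately show False
    using I by simp
qed

end

section \<open>Homomorphisms to the unit interval\<close>

definition mv_unit_hom :: "('a, 'b) mv_algebra_scheme \<Rightarrow> ('a \<Rightarrow> real) \<Rightarrow> bool" where
  "mv_unit_hom A \<phi> \<longleftrightarrow> \<phi> \<zero>\<^bsub>A\<^esub> = 0 \<and> (\<forall>a\<in>carrier A. 0 \<le> \<phi> a \<and> \<phi> a \<le> 1) \<and>
    (\<forall>a\<in>carrier A. \<forall>b\<in>carrier A. \<phi> (a \<oplus>\<^bsub>A\<^esub> b) = min 1 (\<phi> a + \<phi> b)) \<and>
    (\<forall>a\<in>carrier A. \<phi> (\<sim>\<^bsub>A\<^esub> a) = 1 - \<phi> a)"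

lemma mv_unit_homD:
  assumes "mv_unit_hom A \<phi>"
  shows "\<phi> \<zero>\<^bsub>A\<^esub> = 0"
    and "a \<in> carrier A \<Longrightarrow> 0 \<le> \<phi> a" "a \<in> carrier A \<Longrightarrow> \<phi> a \<le> 1"
    and "a \<in> carrier A \<Longrightarrow> b \<in> carrier A \<Longrightarrow> \<phi> (a \<oplus>\<^bsub>A\<^esub> b) = min 1 (\<phi> a + \<phi> b)"
    and "a \<in> carrier A \<Longrightarrow> \<phi> (\<sim>\<^bsub>A\<^esub> a) = 1 - \<phi> a"
  using assms by (auto simp: mv_unit_hom_def)

context mv_algebra
begin

lemma unit_hom_diff:
  assumes "mv_unit_hom A \<phi>" "a \<in> carrier A" "b \<in> carrier A"
  shows "\<phi> (a \<ominus> b) = max 0 (\<phi> a - \<phi> b)"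
  using assms by (auto simp: mv_unit_homD diff_def)

lemma unit_hom_mono:
  assumes "mv_unit_hom A \<phi>" "a \<in> carrier A" "b \<in> carrier A" "a \<sqsubseteq> b"
  shows "\<phi> a \<le> \<phi> b"
  using assms unit_hom_diff[of \<phi> a b] by (simp add: le_iff_diff mv_unit_homD(1)[OF assms(1)])

lemma unit_hom_multiple:
  assumes "mv_unit_hom A \<phi>" "a \<in> carrier A"
  shows "\<phi> (mv_multiple A n a) = min 1 (real n * \<phi> a)"
proof (induction n)
  case (Suc n)
  then show ?case
    using assms mv_unit_homD(2)[OF assms] by (simp add: mv_unit_homD(4) algebra_simps min_def)
qed (use assms in \<open>simp add: mv_unit_homD\<close>)

text \<open>The reals are Archimedean: an element of positive value has a multiple of value 1, whose
  negation lies in the kernel. An ideal containing the kernel and that element therefore contains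
  \<open>\<one>\<close>.\<close>

lemma maximal_ideal_kernel:
  assumes \<phi>: "mv_unit_hom A \<phi>"
  shows "mv_maximal_ideal A {a \<in> carrier A. \<phi> a = 0}" (is "mv_maximal_ideal A ?K")
  unfolding mv_maximal_ideal_def mv_proper_ideal_def
proof (intro conjI allI impI)
  note [simp] = mv_unit_homD[OF \<phi>]
  show "mv_ideal A ?K"
    unfolding mv_ideal_def
  proof (intro conjI ballI impI)
    fix a b assume "b \<in> ?K" "a \<in> carrier A" "a \<sqsubseteq> b"
    then show "a \<in> ?K"
      using unit_hom_mono[OF \<phi>, of a b] mv_unit_homD(2)[OF \<phi> \<open>a \<in> carrier A\<close>] by simp
  qed auto
  have "\<phi> \<one> \<noteq> 0" "\<one> \<in> carrier A"
    by simp_all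
  then show "?K \<noteq> carrier A"
    by blast
next
  fix J
  assume J: "mv_ideal A J \<and> J \<noteq> carrier A" and KJ: "?K \<subseteq> J"
  have "a \<in> ?K" if "a \<in> J" for a
  proof (rule ccontr)
    assume "a \<notin> ?K"
    have a: "a \<in> carrier A"
      using J that ideal_carrierD by auto
    with \<open>a \<notin> ?K\<close> have "\<phi> a > 0"
      using mv_unit_homD(2)[OF \<phi> a] by simp
    then obtain n where "1 < real n * \<phi> a"
      using reals_Archimedean3 by blast
    then have "\<phi> (\<sim> mv_multiple A n a) = 0"
      using a \<phi> by (simp add: mv_unit_homD unit_hom_multiple)
    then have "\<sim> mv_multiple A n a \<in> J"
      using a KJ by auto
    moreover have "mv_multiple A n a \<in> J"
      using J that ideal_multiple by blast
    ultimately have "\<one> \<in> J"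
      using J a ideal_plus_iff[of J "\<sim> mv_multiple A n a" "mv_multiple A n a"] by simp
    then have "carrier A \<subseteq> J"
      using J ideal_downD[of J \<one>] by auto
    then show False
      using J by (auto simp: mv_ideal_def)
  qed
  then show "J = ?K"
    using KJ by blast
qed

lemma unit_hom_quotient:
  assumes I: "mv_ideal A I" and \<phi>: "mv_unit_hom A \<phi>" and "\<And>a. a \<in> I \<Longrightarrow> \<phi> a = 0"
  obtains \<psi> where "mv_unit_hom (mv_quotient A I) \<psi>"
    "\<And>a. a \<in> carrier A \<Longrightarrow> \<psi> (mv_cong A I `` {a}) = \<phi> a"
proof -
  \<comment> \<open>The value is read off an arbitrary representative; \<open>eq\<close> shows that
    the choice does not matter.\<close>
  define \<psi> where "\<psi> C = \<phi> (SOME a. a \<in> C)" for C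
  have eq: "\<phi> a = \<phi> b" if "(a, b) \<in> mv_cong A I" for a b
    using that assms(3)[of "a \<ominus> b"] assms(3)[of "b \<ominus> a"]
    by (simp add: mv_cong_iff[OF I] unit_hom_diff[OF \<phi>] max_def split: if_splits)
  have *: "\<psi> (mv_cong A I `` {a}) = \<phi> a" if "a \<in> carrier A" for a
    unfolding \<psi>_def
  proof (rule someI2)
    show "a \<in> mv_cong A I `` {a}"
      using equiv_class_self[OF equiv_mv_cong[OF I] that] .
  qed (use eq in auto)
  have "mv_unit_hom (mv_quotient A I) \<psi>"
    using \<phi> unfolding mv_unit_hom_def
    by (auto simp: carrier_quotient zero_quotient quotient_plus[OF I] quotient_neg[OF I] *)
  then show ?thesis
    using * that by blast
qed

lemma unit_hom_of_quotient:
  assumes I: "mv_ideal A I" and \<psi>: "mv_unit_hom (mv_quotient A I) \<psi>"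
  shows "mv_unit_hom A (\<lambda>a. \<psi> (mv_cong A I `` {a}))"
  using \<psi> unfolding mv_unit_hom_def
  by (auto simp: carrier_quotient zero_quotient quotient_plus[OF I] quotient_neg[OF I])

end

section \<open>Nontrivial chains and addition with carry\<close>

locale mv_chain = mv_algebra +
  assumes total: "a \<in> carrier A \<Longrightarrow> b \<in> carrier A \<Longrightarrow> mv_le A a b \<or> mv_le A b a"
    and one_neq_zero: "\<one> \<noteq> \<zero>"
begin

text \<open>In a chain only a sum equal to \<open>\<one>\<close> can have been truncated: the
  alternative \<open>\<sim> x \<sqsubseteq> y\<close> says exactly that the sum is
  \<open>\<one>\<close>.\<close>

lemma le_neg_if_plus_neq_one:
  assumes "x \<in> carrier A" "y \<in> carrier A" "x \<oplus> y \<noteq> \<one>"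
  shows "y \<sqsubseteq> \<sim> x"
  using total[of "\<sim> x" y] assms by (auto simp: mv_le_def)

text \<open>The case of associativity in which only y + z carries. Writing y as
  \<open>\<sim> z\<close> plus \<open>y \<odot> z\<close> exhibits \<open>\<sim> z\<close> as a
  summand of \<open>x \<oplus> y\<close> that can be cancelled.\<close>

lemma plus_times_mixed:
  assumes "x \<in> carrier A" "y \<in> carrier A" "z \<in> carrier A" "x \<oplus> y \<noteq> \<one>" "y \<oplus> z = \<one>"
  shows "(x \<oplus> y) \<odot> z = x \<oplus> y \<odot> z" "x \<oplus> y \<odot> z \<noteq> \<one>"
proof -
  let ?w = "y \<odot> z"
  have "\<sim> z \<oplus> ?w = y"
    using assms le_plus_diff[of "\<sim> z" y] by (simp add: mv_le_def diff_def times_def plus_comm)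
  then have eq: "x \<oplus> y = \<sim> z \<oplus> (x \<oplus> ?w)"
    using assms by (metis neg_closed plus_left_comm times_closed)
  then have "x \<oplus> ?w \<sqsubseteq> \<sim> (\<sim> z)"
    using assms by (intro le_neg_if_plus_neq_one) auto
  then have "(x \<oplus> y) \<ominus> \<sim> z = x \<oplus> ?w"
    unfolding eq using assms by (intro plus_diff_cancel) auto
  then show "(x \<oplus> y) \<odot> z = x \<oplus> ?w"
    using assms by (simp add: times_def diff_def)
  show "x \<oplus> ?w \<noteq> \<one>"
    using eq assms by auto
qed

text \<open>A pair \<open>(n, x)\<close> stands for the element \<open>n \<cdot> 1 + x\<close> of the lattice-ordered group with strong unit
  that Chang associates to the chain. The pairs \<open>(n, 1)\<close> and \<open>(n + 1, 0)\<close> represent the same element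
  but are not identified, so addition with carry gives only a commutative semigroup: adding
  \<open>(0, 0)\<close> to \<open>(0, 1)\<close> yields \<open>(1, 0)\<close>.\<close>

definition cadd :: "nat \<times> 'a \<Rightarrow> nat \<times> 'a \<Rightarrow> nat \<times> 'a" where
  "cadd u v = (if snd u \<oplus> snd v = \<one> then (Suc (fst u + fst v), snd u \<odot> snd v)
    else (fst u + fst v, snd u \<oplus> snd v))"

text \<open>The semigroup has no neutral element, hence \<open>cmul u k\<close> is the sum of \<open>k + 1\<close> copies of \<open>u\<close>.\<close>

primrec cmul :: "nat \<times> 'a \<Rightarrow> nat \<Rightarrow> nat \<times> 'a" where
  "cmul u 0 = u"
| "cmul u (Suc k) = cadd (cmul u k) u"

lemma cadd_closed [simp]:
  "snd u \<in> carrier A \<Longrightarrow> snd v \<in> carrier A \<Longrightarrow> snd (cadd u v) \<in> carrier A"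
  by (simp add: cadd_def)

lemma cmul_closed [simp]: "snd u \<in> carrier A \<Longrightarrow> snd (cmul u k) \<in> carrier A"
  by (induction k) auto

lemma fst_cadd: "fst (cadd u v) = fst u + fst v \<or> fst (cadd u v) = Suc (fst u + fst v)"
  by (simp add: cadd_def)

lemma cadd_comm: "snd u \<in> carrier A \<Longrightarrow> snd v \<in> carrier A \<Longrightarrow> cadd u v = cadd v u"
  by (simp add: cadd_def plus_comm times_comm add.commute)

lemma cadd_assoc:
  assumes "snd u \<in> carrier A" "snd v \<in> carrier A" "snd w \<in> carrier A"
  shows "cadd (cadd u v) w = cadd u (cadd v w)"
proof -
  obtain i x j y k z where uvw: "u = (i, x)" "v = (j, y)" "w = (k, z)"
    by (metis surj_pair)
  then have c: "x \<in> carrier A" "y \<in> carrier A" "z \<in> carrier A"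
    using assms by auto
  \<comment> \<open>The cases record which of the two inner sums carries; the second is the mirror
    image of the third.\<close>
  consider "x \<oplus> y = \<one>" "y \<oplus> z = \<one>" | "x \<oplus> y = \<one>" "y \<oplus> z \<noteq> \<one>"
    | "x \<oplus> y \<noteq> \<one>" "y \<oplus> z = \<one>" | "x \<oplus> y \<noteq> \<one>" "y \<oplus> z \<noteq> \<one>"
    by blast
  then show ?thesis
  proof cases
    case 1
    then show ?thesis
      using times_plus_exhaustive[OF c] c by (simp add: uvw cadd_def times_assoc)
  next
    case 2
    have "x \<oplus> (y \<oplus> z) = \<one>"
      using c 2(1) by (simp flip: plus_assoc)
    moreover have "x \<odot> y \<oplus> z \<noteq> \<one>" "x \<odot> (y \<oplus> z) = x \<odot> y \<oplus> z"
      using plus_times_mixed[of z y x] c 2 by (simp_all add: plus_comm times_comm)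
    ultimately show ?thesis
      using 2 by (simp add: uvw cadd_def)
  next
    case 3
    have "(x \<oplus> y) \<oplus> z = \<one>"
      using c 3(2) by (simp add: plus_assoc)
    then show ?thesis
      using plus_times_mixed[OF c 3] 3 by (simp add: uvw cadd_def)
  next
    case 4
    then have "(x \<oplus> y) \<odot> z = x \<odot> (y \<oplus> z)"
      using c by (intro plus_times_disjoint le_neg_if_plus_neq_one) auto
    then show ?thesis
      using 4 c by (simp add: uvw cadd_def plus_assoc)
  qed
qed

lemma cmul_cadd:
  assumes "snd u \<in> carrier A" "snd v \<in> carrier A"
  shows "cmul (cadd u v) k = cadd (cmul u k) (cmul v k)"
proof (induction k)
  case (Suc k)
  let ?a = "cmul u k" and ?b = "cmul v k"
  have "cadd (cadd ?a ?b) (cadd u v) = cadd ?a (cadd ?b (cadd u v))"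
    using assms by (simp add: cadd_assoc)
  also have "cadd ?b (cadd u v) = cadd u (cadd ?b v)"
    using assms by (metis cadd_assoc cadd_comm cmul_closed)
  also have "cadd ?a (cadd u (cadd ?b v)) = cadd (cadd ?a u) (cadd ?b v)"
    using assms by (simp add: cadd_assoc)
  finally show ?case
    using Suc by simp
qed simp

text \<open>The indices are one less than the numbers of copies: (j + 1) + (k + 1) copies have index
  \<open>Suc (j + k)\<close>.\<close>

lemma cmul_Suc_add:
  assumes "snd u \<in> carrier A"
  shows "cmul u (Suc (j + k)) = cadd (cmul u j) (cmul u k)"
  using assms by (induction k) (auto simp: cadd_assoc)

text \<open>The index is (j + 1)(k + 1) - 1, again one less than the number of copies.\<close>

lemma cmul_cmul:
  assumes "snd u \<in> carrier A"
  shows "cmul (cmul u j) k = cmul u (j * k + j + k)"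
proof (induction k)
  case (Suc k)
  have "cmul (cmul u j) (Suc k) = cmul u (Suc ((j * k + j + k) + j))"
    unfolding cmul_Suc_add[OF assms] using Suc by simp
  also have "Suc ((j * k + j + k) + j) = j * Suc k + j + Suc k"
    by simp
  finally show ?case .
qed simp

text \<open>Each of the k additions produces at most one carry.\<close>

lemma fst_cmul_bounds: "Suc k * fst u \<le> fst (cmul u k)" "fst (cmul u k) \<le> Suc k * fst u + k"
proof (induction k)
  case (Suc k)
  { case 1 then show ?case using Suc fst_cadd[of "cmul u k" u] by auto }
  { case 2 then show ?case using Suc fst_cadd[of "cmul u k" u] by auto }
qed simp_all

text \<open>The carry count of a multiple is its integer part, so \<open>rate\<close> is the Hoelder embedding of the
  group into the reals, up to infinitesimals.\<close>

definition rate :: "nat \<times> 'a \<Rightarrow> real" where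
  "rate u = (SUP k. real (fst (cmul u k)) / Suc k)"

lemma rate_bounds:
  assumes "snd u \<in> carrier A"
  shows "real (fst (cmul u k)) \<le> Suc k * rate u" "Suc k * rate u \<le> real (fst (cmul u k)) + 1"
proof -
  \<comment> \<open>The (j + 1)(l + 1)-fold multiple is formed in both orders and its carry count
    bounded from below and from above. Thus every ratio in the supremum is below every ratio with
    one more carry, which gives both finiteness and the upper estimate.\<close>
  have le: "real (fst (cmul u j)) / Suc j \<le> (real (fst (cmul u l)) + 1) / Suc l" for j l
  proof -
    have "Suc l * fst (cmul u j) \<le> fst (cmul (cmul u j) l)"
      by (rule fst_cmul_bounds)
    also have "cmul (cmul u j) l = cmul (cmul u l) j"
      using assms by (simp add: cmul_cmul algebra_simps)
    also have "fst (cmul (cmul u l) j) \<le> Suc j * fst (cmul u l) + j"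
      by (rule fst_cmul_bounds)
    finally have "Suc l * fst (cmul u j) \<le> Suc j * (fst (cmul u l) + 1)"
      by simp
    then have "real (Suc l) * fst (cmul u j) \<le> real (Suc j) * (fst (cmul u l) + 1)"
      by (metis of_nat_le_iff of_nat_mult)
    then show ?thesis
      by (simp add: divide_simps ac_simps)
  qed
  have "real (fst (cmul u k)) / Suc k \<le> rate u"
    unfolding rate_def using le[of _ 0] by (intro cSUP_upper) (auto intro!: bdd_aboveI2)
  then show "real (fst (cmul u k)) \<le> Suc k * rate u"
    by (simp add: divide_simps mult_ac)
  have "rate u \<le> (real (fst (cmul u k)) + 1) / Suc k"
    unfolding rate_def using le by (intro cSUP_least) auto
  then show "Suc k * rate u \<le> real (fst (cmul u k)) + 1"
    by (simp add: divide_simps mult_ac)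
qed

text \<open>Carry counts are additive up to one, and each differs from the scaled rate by at most
  one. The defect multiplied by n + 1 thus stays bounded (3 is a sufficient bound) for all n, so it
  is zero.\<close>

lemma rate_cadd:
  assumes "snd u \<in> carrier A" "snd v \<in> carrier A"
  shows "rate (cadd u v) = rate u + rate v"
proof (rule ccontr)
  let ?d = "rate (cadd u v) - (rate u + rate v)"
  assume "\<not> ?thesis"
  then have "\<bar>?d\<bar> > 0"
    by simp
  then obtain n where n: "3 < real n * \<bar>?d\<bar>"
    using reals_Archimedean3 by blast
  have uv: "snd (cadd u v) \<in> carrier A"
    using assms by simp
  have "real (Suc n) * \<bar>?d\<bar> \<le> 3"
  proof -
    have "\<bar>real (Suc n) * ?d\<bar> \<le> 3"
      using rate_bounds[OF assms(1), of n] rate_bounds[OF assms(2), of n] rate_bounds[OF uv, of n]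
        fst_cadd[of "cmul u n" "cmul v n"]
      unfolding cmul_cadd[OF assms] right_diff_distrib distrib_left by (elim disjE) simp_all
    then show ?thesis
      by (simp add: abs_mult)
  qed
  with n show False
    by (simp add: distrib_right)
qed

lemma unit_hom_rate: "mv_unit_hom A (\<lambda>a. rate (0, a))"
proof -
  have range: "0 \<le> rate (0, a)" "rate (0, a) \<le> 1" if "a \<in> carrier A" for a
    using rate_bounds[of "(0, a)" 0] that by simp_all
  have "cmul (0, \<zero>) k = (0, \<zero>)" for k
    using one_neq_zero by (induction k) (auto simp: cadd_def)
  then have zero: "rate (0, \<zero>) = 0"
    by (simp add: rate_def)
  have "cmul (1, \<zero>) k = (Suc k, \<zero>)" for k
    using one_neq_zero by (induction k) (auto simp: cadd_def)
  then have unit: "rate (1, \<zero>) = 1"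
    by (simp add: rate_def)
  have plus: "rate (0, a \<oplus> b) = min 1 (rate (0, a) + rate (0, b))"
    if ab: "a \<in> carrier A" "b \<in> carrier A" for a b
  proof -
    have sum: "rate (0, a) + rate (0, b) = rate (cadd (0, a) (0, b))"
      using ab by (simp add: rate_cadd)
    show ?thesis
    proof (cases "a \<oplus> b = \<one>")
      case True
      have "rate (1, a \<odot> b) \<ge> 1"
        using rate_bounds(1)[of "(1, a \<odot> b)" 0] ab by simp
      \<comment> \<open>Adding \<open>(0, \<zero>)\<close>, which has rate 0, converts
        \<open>(0, \<one>)\<close> into the other representation \<open>(1, \<zero>)\<close> of the
        unit, so both have rate 1.\<close>
      moreover have "rate (cadd (0, \<one>) (0, \<zero>)) = 1"
        using unit by (simp add: cadd_def times_def)
      then have "rate (0, \<one>) = 1"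
        by (simp add: rate_cadd zero)
      ultimately show ?thesis
        using sum True by (simp add: cadd_def)
    next
      case False
      then show ?thesis
        using sum ab range(2)[of "a \<oplus> b"] by (simp add: cadd_def)
    qed
  qed
  have "rate (0, \<sim> a) = 1 - rate (0, a)" if "a \<in> carrier A" for a
  proof -
    have "cadd (0, a) (0, \<sim> a) = (1, \<zero>)"
      using that by (simp add: cadd_def times_def)
    then show ?thesis
      using rate_cadd[of "(0, a)" "(0, \<sim> a)"] unit that by simp
  qed
  then show ?thesis
    using range zero plus by (simp add: mv_unit_hom_def)
qed

end

text \<open>The quotient by M is a chain, nontrivial because \<open>\<one>\<close> is not in M, so
  its rate map can be pulled back along the projection.\<close>

lemma (in mv_algebra) maximal_ideal_unit_hom:
  assumes M: "mv_maximal_ideal A M"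
  obtains \<phi> where "mv_unit_hom A \<phi>" "\<And>a. a \<in> M \<Longrightarrow> \<phi> a = 0"
proof -
  note I = maximal_idealD[OF M]
  interpret Q: mv_algebra "mv_quotient A M"
    using I(1) by (rule mv_algebra_quotient)
  interpret Q: mv_chain "mv_quotient A M"
  proof
    fix X Y assume "X \<in> carrier (mv_quotient A M)" "Y \<in> carrier (mv_quotient A M)"
    then show "mv_le (mv_quotient A M) X Y \<or> mv_le (mv_quotient A M) Y X"
      using maximal_ideal_total[OF M] by (fastforce simp: carrier_quotient quotient_le_iff[OF I(1)])
  next
    show "mv_neg (mv_quotient A M) (mv_zero (mv_quotient A M)) \<noteq> mv_zero (mv_quotient A M)"
      using I by (simp add: zero_quotient quotient_neg quotient_class_zero_iff)
  qed
  let ?\<phi> = "\<lambda>a. Q.rate (0, mv_cong A M `` {a})"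
  have \<phi>: "mv_unit_hom A ?\<phi>"
    using unit_hom_of_quotient[OF I(1) Q.unit_hom_rate] .
  moreover have "?\<phi> a = 0" if "a \<in> M" for a
    using that I ideal_carrierD[OF I(1) that] mv_unit_homD(1)[OF \<phi>]
    by (metis quotient_class_zero_iff)
  ultimately show ?thesis
    using that by blast
qed

section \<open>One-sided affine germs\<close>

text \<open>The direction \<sigma> lets one filter at 0 serve both sides of x (with values 1 and
  -1). The condition is local, so no list of breakpoints has to be carried along; compactness later
  makes the estimates uniform.\<close>

definition germ_affine :: "(real \<Rightarrow> real) \<Rightarrow> bool" where
  "germ_affine F \<longleftrightarrow>
    (\<forall>x \<sigma>. \<exists>s. \<forall>\<^sub>F e in at_right 0. F (x + \<sigma> * e) = F x + s * e)"

lemma germ_affineD: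
  assumes "germ_affine F"
  obtains s where "\<forall>\<^sub>F e in at_right 0. F (x + \<sigma> * e) = F x + s * e"
  using assms unfolding germ_affine_def by blast

lemma germ_affine_ident: "germ_affine (\<lambda>x. x)"
  by (auto simp: germ_affine_def)

lemma germ_affine_const: "germ_affine (\<lambda>x. c)"
  by (auto simp: germ_affine_def intro: exI[of _ 0])

lemma germ_affine_one_minus:
  assumes "germ_affine F"
  shows "germ_affine (\<lambda>x. 1 - F x)"
  unfolding germ_affine_def
proof (intro allI)
  fix x \<sigma>
  obtain s where "\<forall>\<^sub>F e in at_right 0. F (x + \<sigma> * e) = F x + s * e"
    using germ_affineD[OF assms] .
  then have "\<forall>\<^sub>F e in at_right 0. 1 - F (x + \<sigma> * e) = 1 - F x + (- s) * e"
    by eventually_elim simp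
  then show "\<exists>s. \<forall>\<^sub>F e in at_right 0. 1 - F (x + \<sigma> * e) = 1 - F x + s * e"
    by blast
qed

lemma min_affine_germ:
  fixes v s :: real
  obtains s' where "\<forall>\<^sub>F e in at_right 0. min 1 (v + s * e) = min 1 v + s' * e"
proof -
  have lim: "((\<lambda>e. v + s * e) \<longlongrightarrow> v) (at_right 0)"
    by (auto intro!: tendsto_eq_intros)
  have pos: "\<forall>\<^sub>F e::real in at_right 0. 0 < e"
    by (rule eventually_at_right_less)
  consider "v < 1" | "v > 1" | "v = 1"
    by linarith
  then show ?thesis
  proof cases
    case 1
    have "\<forall>\<^sub>F e in at_right 0. min 1 (v + s * e) = min 1 v + s * e"
      using order_tendstoD(2)[OF lim 1] by eventually_elim (use 1 in simp)
    then show ?thesis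
      using that by blast
  next
    case 2
    have "\<forall>\<^sub>F e in at_right 0. min 1 (v + s * e) = min 1 v + 0 * e"
      using order_tendstoD(1)[OF lim 2] by eventually_elim (use 2 in simp)
    then show ?thesis
      using that by blast
  next
    case 3
    \<comment> \<open>At the threshold itself truncation removes exactly a positive slope.\<close>
    have "\<forall>\<^sub>F e in at_right 0. min 1 (v + s * e) = min 1 v + min 0 s * e"
      using pos
    proof eventually_elim
      case (elim e)
      then show ?case
        using 3 by (cases "s \<ge> 0") (simp_all add: mult_nonpos_nonneg)
    qed
    then show ?thesis
      using that by blast
  qed
qed

lemma germ_affine_min_plus:
  assumes "germ_affine F" "germ_affine G"
  shows "germ_affine (\<lambda>x. min 1 (F x + G x))"
  unfolding germ_affine_def
proof (intro allI)
  fix x \<sigma>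
  obtain s where s: "\<forall>\<^sub>F e in at_right 0. F (x + \<sigma> * e) = F x + s * e"
    using germ_affineD[OF assms(1)] .
  obtain t where t: "\<forall>\<^sub>F e in at_right 0. G (x + \<sigma> * e) = G x + t * e"
    using germ_affineD[OF assms(2)] .
  obtain s' where s':
    "\<forall>\<^sub>F e in at_right 0. min 1 ((F x + G x) + (s + t) * e) = min 1 (F x + G x) + s' * e"
    using min_affine_germ .
  have "\<forall>\<^sub>F e in at_right 0.
    min 1 (F (x + \<sigma> * e) + G (x + \<sigma> * e)) = min 1 (F x + G x) + s' * e"
    using s t s' by eventually_elim (simp add: algebra_simps)
  then show "\<exists>s. \<forall>\<^sub>F e in at_right 0.
    min 1 (F (x + \<sigma> * e) + G (x + \<sigma> * e)) = min 1 (F x + G x) + s * e"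
    by blast
qed

section \<open>Domination by a multiple: at a zero, near a point, on a compact set\<close>

lemma eventually_nhds_two_sided:
  fixes x :: real
  assumes "P x" "\<forall>\<^sub>F e in at_right 0. P (x + 1 * e)" "\<forall>\<^sub>F e in at_right 0. P (x + (- 1) * e)"
  shows "eventually P (nhds x)"
proof -
  have "eventually P (at_right x)"
    using assms(2) by (simp add: eventually_at_right_to_0[of _ x] add.commute)
  moreover have "eventually P (at_left x)"
    using assms(3) by (simp add: eventually_at_left_to_right eventually_at_right_to_0[of _ "- x"])
  ultimately show ?thesis
    using assms(1) by (simp add: eventually_nhds_conv_at eventually_at_split)
qed

text \<open>Along the chosen direction F and H are s * e and t * e. If t > 0, any k above s / t
  works; if t = 0, then H vanishes at the nearby points and hence F vanishes at those in X.\<close>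

lemma germ_affine_dominated_at_zero:
  fixes F H :: "real \<Rightarrow> real" and x \<sigma> :: real
  assumes F: "germ_affine F" and H: "germ_affine H" and x: "F x = 0" "H x = 0"
    and nonneg: "\<And>y. y \<in> X \<Longrightarrow> 0 \<le> H y"
    and zero: "\<And>y. y \<in> X \<Longrightarrow> H y = 0 \<Longrightarrow> F y = 0"
  obtains k :: nat
  where "\<forall>\<^sub>F e in at_right 0. x + \<sigma> * e \<in> X \<longrightarrow> F (x + \<sigma> * e) \<le> k * H (x + \<sigma> * e)"
proof -
  obtain s where s: "\<forall>\<^sub>F e in at_right 0. F (x + \<sigma> * e) = F x + s * e"
    using germ_affineD[OF F] .
  obtain t where t: "\<forall>\<^sub>F e in at_right 0. H (x + \<sigma> * e) = H x + t * e"
    using germ_affineD[OF H] .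
  have pos: "\<forall>\<^sub>F e::real in at_right 0. 0 < e"
    by (rule eventually_at_right_less)
  obtain k :: nat where k: "s / t \<le> k"
    using real_arch_simple by blast
  have "\<forall>\<^sub>F e in at_right 0. x + \<sigma> * e \<in> X \<longrightarrow> F (x + \<sigma> * e) \<le> k * H (x + \<sigma> * e)"
    using s t pos
  proof eventually_elim
    case (elim e)
    show ?case
    proof
      assume y: "x + \<sigma> * e \<in> X"
      \<comment> \<open>A negative t is impossible here: it would make H negative at a point of
        X.\<close>
      have "0 \<le> t * e"
        using nonneg[OF y] elim x by simp
      then consider "t = 0" | "t > 0"
        using elim(3) by (force simp: zero_le_mult_iff)
      then show "F (x + \<sigma> * e) \<le> k * H (x + \<sigma> * e)"
      proof cases
        case 1
        then show ?thesis
          using zero[OF y] elim x by simp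
      next
        case 2
        then have "s \<le> k * t"
          using k by (simp add: divide_simps)
        then have "s * e \<le> k * t * e"
          using elim(3) by (intro mult_right_mono) auto
        then show ?thesis
          using elim x by simp
      qed
    qed
  qed
  then show ?thesis
    using that by blast
qed

lemma germ_affine_dominated_locally:
  fixes F H :: "real \<Rightarrow> real" and x :: real
  assumes F: "germ_affine F" and H: "germ_affine H" "continuous_on UNIV H" and x: "x \<in> X"
    and nonneg: "\<And>y. y \<in> X \<Longrightarrow> 0 \<le> H y"
    and bounded: "\<And>y. y \<in> X \<Longrightarrow> F y \<le> 1"
    and zero: "\<And>y. y \<in> X \<Longrightarrow> H y = 0 \<Longrightarrow> F y = 0"
  obtains k :: nat where "\<forall>\<^sub>F y in nhds x. y \<in> X \<longrightarrow> F y \<le> k * H y"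
proof (cases "H x = 0")
  case True
  have Fx: "F x = 0"
    using zero x True by simp
  note loc = germ_affine_dominated_at_zero[OF F H(1) Fx True nonneg zero]
  obtain k :: nat where
    k: "\<forall>\<^sub>F e in at_right 0. x + 1 * e \<in> X \<longrightarrow> F (x + 1 * e) \<le> k * H (x + 1 * e)"
    using loc[where \<sigma> = 1] by blast
  obtain l :: nat where
    l: "\<forall>\<^sub>F e in at_right 0. x + (-1) * e \<in> X \<longrightarrow> F (x + (-1) * e) \<le> l * H (x + (-1) * e)"
    using loc[where \<sigma> = "-1"] by blast
  \<comment> \<open>As H is nonnegative on X, the sum of the two one-sided multipliers serves on
    both sides.\<close>
  have mono: "F y \<le> (k + l) * H y" if "y \<in> X" "F y \<le> k * H y \<or> F y \<le> l * H y" for y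
    using that nonneg[OF that(1)] by (auto simp: distrib_right intro: add_increasing add_increasing2)
  have "\<forall>\<^sub>F y in nhds x. y \<in> X \<longrightarrow> F y \<le> (k + l) * H y"
  proof (rule eventually_nhds_two_sided)
    show "\<forall>\<^sub>F e in at_right 0. x + 1 * e \<in> X \<longrightarrow> F (x + 1 * e) \<le> (k + l) * H (x + 1 * e)"
      using k by eventually_elim (use mono in blast)
    show "\<forall>\<^sub>F e in at_right 0. x + (-1) * e \<in> X \<longrightarrow> F (x + (-1) * e) \<le> (k + l) * H (x + (-1) * e)"
      using l by eventually_elim (use mono in blast)
  qed (use True Fx in simp)
  then show ?thesis
    using that by blast
next
  case False
  then have Hx: "0 < H x / 2"
    using nonneg[OF x] by simp
  \<comment> \<open>Near x continuity keeps H above H x / 2, while F is at most 1 on X.\<close>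
  obtain k :: nat where k: "1 < k * (H x / 2)"
    using reals_Archimedean3[OF Hx] by blast
  have "isCont H x"
    using H(2) by (simp add: continuous_on_eq_continuous_at)
  then have "(H \<longlongrightarrow> H x) (nhds x)"
    by (simp add: continuous_at tendsto_nhds_iff)
  then have "\<forall>\<^sub>F y in nhds x. H x / 2 < H y"
    using Hx by (intro order_tendstoD) auto
  then have "\<forall>\<^sub>F y in nhds x. y \<in> X \<longrightarrow> F y \<le> k * H y"
  proof eventually_elim
    case (elim y)
    have "k * (H x / 2) \<le> k * H y"
      using elim by (intro mult_left_mono) auto
    then show ?case
      using k bounded[of y] by auto
  qed
  then show ?thesis
    using that by blast
qed

lemma germ_affine_dominated:
  fixes F H :: "real \<Rightarrow> real"
  assumes "compact X" and F: "germ_affine F" and H: "germ_affine H" "continuous_on UNIV H"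
    and nonneg: "\<And>y. y \<in> X \<Longrightarrow> 0 \<le> H y"
    and bounded: "\<And>y. y \<in> X \<Longrightarrow> F y \<le> 1"
    and zero: "\<And>y. y \<in> X \<Longrightarrow> H y = 0 \<Longrightarrow> F y = 0"
  obtains k :: nat where "\<And>y. y \<in> X \<Longrightarrow> F y \<le> k * H y"
proof -
  have "\<exists>(k::nat) U. open U \<and> x \<in> U \<and> (\<forall>y\<in>U. y \<in> X \<longrightarrow> F y \<le> k * H y)" if "x \<in> X" for x
    using germ_affine_dominated_locally[OF F H that nonneg bounded zero]
    unfolding eventually_nhds by metis
  then obtain k :: "real \<Rightarrow> nat" and U where
    U: "\<And>x. x \<in> X \<Longrightarrow> open (U x)" "\<And>x. x \<in> X \<Longrightarrow> x \<in> U x"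
      "\<And>x y. x \<in> X \<Longrightarrow> y \<in> U x \<Longrightarrow> y \<in> X \<Longrightarrow> F y \<le> k x * H y"
    by metis
  obtain D where D: "D \<subseteq> X" "finite D" "X \<subseteq> (\<Union>x\<in>D. U x)"
    using compactE_image[OF \<open>compact X\<close>, of X U] U by blast
  \<comment> \<open>The sum over the finite subcover exceeds each local multiplier.\<close>
  have "F y \<le> (\<Sum>x\<in>D. k x) * H y" if y: "y \<in> X" for y
  proof -
    obtain x where x: "x \<in> D" "y \<in> U x"
      using D y by blast
    then have "F y \<le> k x * H y"
      using U(3) D y by blast
    also have "\<dots> \<le> (\<Sum>x\<in>D. k x) * H y"
      using x D nonneg[OF y] by (intro mult_right_mono) (auto intro: member_le_sum)
    finally show ?thesis .
  qed
  then show ?thesis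
    using that by blast
qed

section \<open>Algebras with one generator\<close>

context mv_algebra
begin

lemma generate_subset:
  assumes "S \<subseteq> carrier A"
  shows "mv_generate A S \<subseteq> carrier A"
proof
  fix b assume "b \<in> mv_generate A S"
  then show "b \<in> carrier A"
    by induction (use assms in auto)
qed

text \<open>Evaluating in the reals the term that builds b from a gives F, so a single F serves all
  homomorphisms at once.\<close>

lemma generated_germ_affine:
  assumes "a \<in> carrier A" "b \<in> mv_generate A {a}"
  shows "\<exists>F. continuous_on UNIV F \<and> germ_affine F \<and> (\<forall>\<phi>. mv_unit_hom A \<phi> \<longrightarrow> \<phi> b = F (\<phi> a))"
  using assms(2)
proof induction
  case zero
  show ?case
    by (rule exI[of _ "\<lambda>x. 0"]) (auto simp: germ_affine_const mv_unit_homD)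
next
  case (incl b)
  then show ?case
    by (intro exI[of _ "\<lambda>x. x"]) (auto simp: germ_affine_ident)
next
  case (plus b c)
  then obtain F G where FG: "continuous_on UNIV F" "germ_affine F" "continuous_on UNIV G" "germ_affine G"
    "\<And>\<phi>. mv_unit_hom A \<phi> \<Longrightarrow> \<phi> b = F (\<phi> a)" "\<And>\<phi>. mv_unit_hom A \<phi> \<Longrightarrow> \<phi> c = G (\<phi> a)"
    by blast
  have "b \<in> carrier A" "c \<in> carrier A"
    using plus.hyps generate_subset[of "{a}"] assms(1) by auto
  then show ?case
    using FG by (intro exI[of _ "\<lambda>x. min 1 (F x + G x)"])
      (auto intro!: continuous_intros germ_affine_min_plus simp: mv_unit_homD(4))
next
  case (neg b)
  then obtain F where F: "continuous_on UNIV F" "germ_affine F"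
    "\<And>\<phi>. mv_unit_hom A \<phi> \<Longrightarrow> \<phi> b = F (\<phi> a)"
    by blast
  have "b \<in> carrier A"
    using neg.hyps generate_subset[of "{a}"] assms(1) by auto
  then show ?case
    using F by (intro exI[of _ "\<lambda>x. 1 - F x"])
      (auto intro!: continuous_intros germ_affine_one_minus simp: mv_unit_homD(5))
qed

text \<open>The spectrum is closed because evaluation at a limit point of it is again a homomorphism.\<close>

lemma compact_spectrum:
  assumes a: "a \<in> carrier A" and cont: "\<And>b. b \<in> carrier A \<Longrightarrow> continuous_on UNIV (F b)"
    and F: "\<And>b \<phi>. b \<in> carrier A \<Longrightarrow> mv_unit_hom A \<phi> \<Longrightarrow> \<phi> b = F b (\<phi> a)"
  shows "compact {\<phi> a |\<phi>. mv_unit_hom A \<phi>}" (is "compact ?X")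
proof -
  \<comment> \<open>A closed condition that holds on the spectrum holds on its closure; each
    homomorphism law for \<open>F b x\<close> is such a condition.\<close>
  have extend: "P x" if "closed {x. P x}" "\<And>\<phi>. mv_unit_hom A \<phi> \<Longrightarrow> P (\<phi> a)" "x \<in> closure ?X" for P x
  proof -
    have "closure ?X \<subseteq> {x. P x}"
      using that(1,2) by (intro closure_minimal) auto
    then show ?thesis
      using that(3) by auto
  qed
  note [continuous_intros] = cont
  have "x \<in> ?X" if x: "x \<in> closure ?X" for x
  proof -
    have "mv_unit_hom A (\<lambda>b. F b x)"
      unfolding mv_unit_hom_def
    proof (intro conjI ballI)
      show "F \<zero> x = 0"
        by (rule extend[OF _ _ x])
          (auto intro!: closed_Collect_eq continuous_intros simp: mv_unit_homD simp flip: F)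
    next
      fix b assume b: "b \<in> carrier A"
      show "0 \<le> F b x"
        by (rule extend[OF _ _ x])
          (use b in \<open>auto intro!: closed_Collect_le continuous_intros simp: mv_unit_homD simp flip: F\<close>)
      show "F b x \<le> 1"
        by (rule extend[OF _ _ x])
          (use b in \<open>auto intro!: closed_Collect_le continuous_intros simp: mv_unit_homD simp flip: F\<close>)
      show "F (\<sim> b) x = 1 - F b x"
        by (rule extend[OF _ _ x])
          (use b in \<open>auto intro!: closed_Collect_eq continuous_intros simp: mv_unit_homD simp flip: F\<close>)
      fix c assume c: "c \<in> carrier A"
      show "F (b \<oplus> c) x = min 1 (F b x + F c x)"
        by (rule extend[OF _ _ x])
          (use b c in \<open>auto intro!: closed_Collect_eq continuous_intros simp: mv_unit_homD simp flip: F\<close>)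
    qed
    \<comment> \<open>This identifies x as the value at a of the homomorphism just built.\<close>
    moreover have "F a x = x"
      by (rule extend[OF _ _ x])
        (use a in \<open>auto intro!: closed_Collect_eq continuous_intros simp flip: F\<close>)
    ultimately show ?thesis
      by (intro CollectI exI[of _ "\<lambda>b. F b x"]) simp
  qed
  then have "closed ?X"
    using closure_subset[of ?X] closure_eq[of ?X] by blast
  moreover have "?X \<subseteq> {0..1}"
    using a by (auto simp: mv_unit_homD)
  ultimately show ?thesis
    using compact_Int_closed[of "{0..1}" ?X] by (simp add: Int_absorb1)
qed

text \<open>Every maximal ideal is contained in the kernel of some homomorphism and equals it by
  maximality, so b lies in all maximal ideals.\<close>

lemma semisimple_eq_zero:
  assumes "mv_semisimple A" "b \<in> carrier A" "\<And>\<phi>. mv_unit_hom A \<phi> \<Longrightarrow> \<phi> b = 0"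
  shows "b = \<zero>"
proof -
  have "b \<in> M" if M: "mv_maximal_ideal A M" for M
  proof -
    obtain \<phi> where \<phi>: "mv_unit_hom A \<phi>" "\<And>a. a \<in> M \<Longrightarrow> \<phi> a = 0"
      using maximal_ideal_unit_hom[OF M] by blast
    have "mv_maximal_ideal A {a \<in> carrier A. \<phi> a = 0}"
      using \<phi>(1) by (rule maximal_ideal_kernel)
    moreover have "M \<subseteq> {a \<in> carrier A. \<phi> a = 0}"
      using \<phi>(2) maximal_idealD(1)[OF M] ideal_carrierD by blast
    ultimately have "{a \<in> carrier A. \<phi> a = 0} = M"
      using M by (auto simp: mv_maximal_ideal_def)
    then show ?thesis
      using assms(2,3) \<phi>(1) by blast
  qed
  then show ?thesis
    using assms(1,2) unfolding mv_semisimple_def by blast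
qed

lemma principal_ideal_if_vanishing:
  assumes a: "a \<in> carrier A" and gen: "mv_generate A {a} = carrier A" and ss: "mv_semisimple A"
    and fh: "f \<in> carrier A" "h \<in> carrier A"
    and zero: "\<And>\<phi>. mv_unit_hom A \<phi> \<Longrightarrow> \<phi> h = 0 \<Longrightarrow> \<phi> f = 0"
  shows "f \<in> mv_principal_ideal A h"
proof -
  have "\<forall>b\<in>carrier A. \<exists>F. continuous_on UNIV F \<and> germ_affine F \<and>
      (\<forall>\<phi>. mv_unit_hom A \<phi> \<longrightarrow> \<phi> b = F (\<phi> a))"
    using generated_germ_affine[OF a] gen by simp
  then obtain F where F: "\<And>b. b \<in> carrier A \<Longrightarrow> continuous_on UNIV (F b)"
    "\<And>b. b \<in> carrier A \<Longrightarrow> germ_affine (F b)"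
    "\<And>b \<phi>. b \<in> carrier A \<Longrightarrow> mv_unit_hom A \<phi> \<Longrightarrow> \<phi> b = F b (\<phi> a)"
    by metis
  define X where "X = {\<phi> a |\<phi>. mv_unit_hom A \<phi>}"
  have "compact X"
    unfolding X_def using compact_spectrum[OF a F(1,3)] .
  moreover have "0 \<le> F h y" "F f y \<le> 1" "F h y = 0 \<Longrightarrow> F f y = 0" if "y \<in> X" for y
    using that fh zero by (auto simp: X_def mv_unit_homD simp flip: F(3))
  ultimately obtain k :: nat where k: "\<And>y. y \<in> X \<Longrightarrow> F f y \<le> k * F h y"
    using germ_affine_dominated[of X "F f" "F h"] F fh by metis
  have "\<phi> (f \<ominus> mv_multiple A k h) = 0" if \<phi>: "mv_unit_hom A \<phi>" for \<phi>
  proof -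
    have "\<phi> f \<le> k * \<phi> h"
      using k[of "\<phi> a"] F(3)[OF _ \<phi>] fh \<phi> by (auto simp: X_def)
    \<comment> \<open>The multiple has value min 1 (k * \<phi> h); this truncation is harmless
      because \<phi> f is at most 1.\<close>
    then show ?thesis
      using fh mv_unit_homD(3)[OF \<phi> fh(1)] by (simp add: unit_hom_diff[OF \<phi>] unit_hom_multiple[OF \<phi>])
  qed
  then have "f \<ominus> mv_multiple A k h = \<zero>"
    using fh by (intro semisimple_eq_zero[OF ss]) auto
  then show ?thesis
    using fh by (auto simp: mv_principal_ideal_def le_iff_diff)
qed

end

theorem theorem2p1:
  fixes A :: "('a, 'b) mv_algebra_scheme"
  assumes "mv_algebra A"
    and "\<exists>g\<in>carrier A. mv_generate A {g} = carrier A"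
    and "mv_semisimple A"
  shows "mv_strongly_semisimple A"
  unfolding mv_strongly_semisimple_def
proof
  interpret mv_algebra A by fact
  obtain a where a: "a \<in> carrier A" "mv_generate A {a} = carrier A"
    using assms(2) by blast
  fix h assume h: "h \<in> carrier A"
  define I where "I = mv_principal_ideal A h"
  have I: "mv_ideal A I"
    unfolding I_def using h by (rule ideal_principal)
  interpret Q: mv_algebra "mv_quotient A I"
    using I by (rule mv_algebra_quotient)
  have "X = mv_zero (mv_quotient A I)"
    if X: "X \<in> carrier (mv_quotient A I)" "\<And>M. mv_maximal_ideal (mv_quotient A I) M \<Longrightarrow> X \<in> M" for X
  proof -
    obtain f where f: "f \<in> carrier A" "X = mv_cong A I `` {f}"
      using X(1) by (auto simp: carrier_quotient)
    \<comment> \<open>Such a \<phi> vanishes on the whole ideal I and descends to the quotient. The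
      kernel there is a maximal ideal, so it contains X, the class of f.\<close>
    have "\<phi> f = 0" if \<phi>: "mv_unit_hom A \<phi>" "\<phi> h = 0" for \<phi>
    proof -
      have "\<phi> b = 0" if "b \<in> I" for b
      proof -
        obtain k where b: "b \<in> carrier A" "b \<sqsubseteq> mv_multiple A k h"
          using \<open>b \<in> I\<close> by (auto simp: I_def mv_principal_ideal_def)
        then have "\<phi> b \<le> \<phi> (mv_multiple A k h)"
          using h by (intro unit_hom_mono[OF \<phi>(1)]) auto
        then show ?thesis
          using mv_unit_homD(2)[OF \<phi>(1) b(1)] \<phi>(2) h by (simp add: unit_hom_multiple[OF \<phi>(1)])
      qed
      then obtain \<psi> where \<psi>: "mv_unit_hom (mv_quotient A I) \<psi>"
        "\<And>a. a \<in> carrier A \<Longrightarrow> \<psi> (mv_cong A I `` {a}) = \<phi> a"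
        using unit_hom_quotient[OF I \<phi>(1)] by metis
      show ?thesis
        using X(2)[OF Q.maximal_ideal_kernel[OF \<psi>(1)]] \<psi>(2)[OF f(1)] f(2) by simp
    qed
    then have "f \<in> I"
      unfolding I_def using a assms(3) f(1) h by (intro principal_ideal_if_vanishing) auto
    then show ?thesis
      using I f by (simp add: zero_quotient quotient_class_zero_iff)
  qed
  moreover have "mv_zero (mv_quotient A I) \<in> M" if "mv_maximal_ideal (mv_quotient A I) M" for M
    using Q.maximal_idealD(1)[OF that] by (simp add: mv_ideal_def)
  ultimately show "mv_semisimple (mv_quotient A (mv_principal_ideal A h))"
    unfolding mv_semisimple_def I_def[symmetric] using Q.zero_closed by blast
qed

end
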